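(* Let $M_m(\lambda)$ be the Fourier symbols and $\beta_{m,n}(\lambda)$ their eigenvalues, as in the context, and suppose there are an integer $m_c\ge1$ and $\lambda_c\in\mathbb R$ such that (i) $\operatorname{tr}M_{m_c}(\lambda_c)=0$; (ii) $\det M_m(\lambda_c)>0$ for all $m\in\mathbb Z\setminus\{0\}$; (iii) $\frac{d}{d\lambda}\operatorname{tr}M_{m_c}(\lambda_c)\ne0$; (iv) $\operatorname{tr}M_m(\lambda_c)<0$ for all $m\in\mathbb Z\setminus\{0\}$ with $m\neq\pm m_c$. Then $$\sup_{m\in\mathbb Z\setminus\{0,m_c,-m_c\},\ n\in\{1,2\}}\operatorname{Re}\beta_{m,n}(\lambda_c)<0$$ holds if and only if $$\liminf_{m\to\infty}\frac{\det M_m(\lambda_c)}{|\operatorname{tr}M_m(\lambda_c)|}>0.$$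
   Context: Let $m_L\ge1$ be an integer and $b_{i,k}=b_{i,k}(\lambda)\in\mathbb R$ ($i=1,2$, $0\le k\le2m_L+1$) smooth functions of $\lambda\in\mathbb R$. For $m\in\mathbb Z\setminus\{0\}$ let $$M_m(\lambda)=\sum_{k=0}^{m_L}(-1)^k\begin{bmatrix}b_{1,2k}m^{2k}& i\,b_{1,2k+1}m^{2k+1}\\ i\,b_{2,2k+1}m^{2k+1}& b_{2,2k}m^{2k}\end{bmatrix},$$ the Fourier symbol ($\partial_x\mapsto im$) of the operator $L_\lambda=(L_{ij})$ with $L_{11}=\sum_kb_{1,2k}\partial_x^{2k}$, $L_{12}=\sum_kb_{1,2k+1}\partial_x^{2k+1}$, $L_{21}=\sum_kb_{2,2k+1}\partial_x^{2k+1}$, $L_{22}=\sum_kb_{2,2k}\partial_x^{2k}$ acting on mean-zero $2\pi$-periodic pairs. $\beta_{m,1},\beta_{m,2}$ denote the two roots (with multiplicity) of $\beta^2-\operatorname{tr}(M_m)\beta+\det M_m=0$. *)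

theory Defs
  imports "HOL-Analysis.Analysis" "HOL-Computational_Algebra.Polynomial"
begin

definition smooth :: "(real \<Rightarrow> real) \<Rightarrow> bool" where
  "smooth f \<longleftrightarrow> (\<forall>n x. ((deriv ^^ n) f) field_differentiable (at x))"

(* The coefficient b_{i,k}(lambda) is written b i k l; only i = 1, 2 and
   k <= 2 mL + 1 are used. *)
definition symb :: "nat \<Rightarrow> (nat \<Rightarrow> nat \<Rightarrow> real \<Rightarrow> real) \<Rightarrow> real \<Rightarrow> int \<Rightarrow> complex^2^2" where
  "symb mL b l m = (\<Sum>k\<le>mL. (-1)^k *\<^sub>R
     vector [vector [of_real (b 1 (2*k) l) * of_int m ^ (2*k),
                     \<i> * of_real (b 1 (2*k+1) l) * of_int m ^ (2*k+1)],
             vector [\<i> * of_real (b 2 (2*k+1) l) * of_int m ^ (2*k+1),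
                     of_real (b 2 (2*k) l) * of_int m ^ (2*k)]])"

(* Trace and determinant of the complex matrix symb are real (lemmas
   trace_symb and det_symb), so they are recorded as real numbers. *)
definition symb_tr :: "nat \<Rightarrow> (nat \<Rightarrow> nat \<Rightarrow> real \<Rightarrow> real) \<Rightarrow> real \<Rightarrow> int \<Rightarrow> real" where
  "symb_tr mL b l m = Re (trace (symb mL b l m))"

definition symb_det :: "nat \<Rightarrow> (nat \<Rightarrow> nat \<Rightarrow> real \<Rightarrow> real) \<Rightarrow> real \<Rightarrow> int \<Rightarrow> real" where
  "symb_det mL b l m = Re (det (symb mL b l m))"

lemma symb_entries:
  "symb mL b l m $ 1 $ 1 = of_real (\<Sum>k\<le>mL. (-1)^k * b 1 (2*k) l * of_int m ^ (2*k))"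
  "symb mL b l m $ 1 $ 2 = \<i> * of_real (\<Sum>k\<le>mL. (-1)^k * b 1 (2*k+1) l * of_int m ^ (2*k+1))"
  "symb mL b l m $ 2 $ 1 = \<i> * of_real (\<Sum>k\<le>mL. (-1)^k * b 2 (2*k+1) l * of_int m ^ (2*k+1))"
  "symb mL b l m $ 2 $ 2 = of_real (\<Sum>k\<le>mL. (-1)^k * b 2 (2*k) l * of_int m ^ (2*k))"
  unfolding symb_def of_real_sum sum_distrib_left
  by (simp_all add: scaleR_conv_of_real[where ?'a=complex] mult_ac del: power_Suc power_mult)

lemma trace_symb: "trace (symb mL b l m) = of_real (symb_tr mL b l m)"
  by (simp add: symb_tr_def trace_def sum_2 symb_entries complex_eq_iff del: of_real_sum)

lemma det_symb: "det (symb mL b l m) = of_real (symb_det mL b l m)"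
  by (simp add: symb_det_def det_2 symb_entries complex_eq_iff del: of_real_sum)

(* r, s are the two roots, listed with multiplicity, of the characteristic
   polynomial x^2 - tr(A) x + det(A). *)
definition eigenvalue_pair :: "complex^2^2 \<Rightarrow> complex \<Rightarrow> complex \<Rightarrow> bool" where
  "eigenvalue_pair A r s \<longleftrightarrow> [:det A, - trace A, 1:] = [:- r, 1:] * [:- s, 1:]"

end

theory Submission
  imports Defs
begin

text \<open>
  Write \<open>t\<^sub>m < 0\<close> and \<open>d\<^sub>m > 0\<close> for the trace and the determinant at the critical parameter, for
  \<open>m\<close> outside \<open>{0, m\<^sub>c, -m\<^sub>c}\<close>, and let \<open>\<mu>\<^sub>m\<close> be the larger real part of the two eigenvalues.  The
  eigenvalues are either real, and then \<open>-\<mu>\<^sub>m\<close> is the smaller of two positive numbers with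
  product \<open>d\<^sub>m\<close> and sum \<open>\<bar>t\<^sub>m\<bar>\<close>, or conjugate, and then \<open>-\<mu>\<^sub>m = \<bar>t\<^sub>m\<bar> / 2\<close>.  In both cases
  \<open>min (d\<^sub>m / \<bar>t\<^sub>m\<bar>) (\<bar>t\<^sub>m\<bar> / 2) \<le> - \<mu>\<^sub>m \<le> 2 d\<^sub>m / \<bar>t\<^sub>m\<bar>\<close>
  (\<open>min_le_neg_Re_root\<close> and \<open>neg_Re_root_le\<close>).  The upper bound turns a spectral gap into a
  positive lower bound for \<open>d\<^sub>m / \<bar>t\<^sub>m\<bar>\<close>.

  For the converse, the term \<open>\<bar>t\<^sub>m\<bar> / 2\<close> has to stay away from \<open>0\<close>, which the sign conditions alone
  do not give.  Here it matters that \<open>t\<^sub>m\<close> is a polynomial in \<open>m\<close>: a real polynomial that is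
  positive at all large integers is eventually at least its leading coefficient, which is
  positive (\<open>poly_bounded_below_of_eventually_pos\<close>).  So the left-hand side above is bounded below
  for large positive \<open>m\<close>.  Trace and determinant are even in \<open>m\<close>, so only the finitely many \<open>m\<close>
  with small \<open>\<bar>m\<bar>\<close> remain, and these cannot destroy a positive bound.
\<close>

section \<open>Real parts of the roots of a stable real quadratic\<close>

lemma eigenvalue_pair_iff:
  "eigenvalue_pair A r s \<longleftrightarrow> r + s = trace A \<and> r * s = det A"
  unfolding eigenvalue_pair_def by (auto simp: algebra_simps neg_eq_iff_add_eq_0)

lemma roots_real_or_same_Re:
  assumes "r + s = complex_of_real t" and "r * s = complex_of_real d"
  shows "Im r = 0 \<and> Im s = 0 \<or> Re r = Re s"
proof -
  have im: "Im r = - Im s"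
    using arg_cong[OF assms(1), of Im] by simp
  have "Re r * Im s + Im r * Re s = 0"
    using arg_cong[OF assms(2), of Im] by simp
  then have "Im s * (Re r - Re s) = 0"
    using im by (simp add: algebra_simps)
  then show ?thesis
    using im by auto
qed

text \<open>
  For real roots \<open>-x\<close> and \<open>-y\<close>, the value \<open>d / \<bar>t\<bar> = x y / (x + y)\<close> is the product of \<open>x\<close> with a
  factor below \<open>1\<close>; for conjugate roots the real part is exactly \<open>t / 2\<close>.
\<close>

lemma min_le_neg_Re_root:
  assumes sum: "r + s = complex_of_real t" and prod: "r * s = complex_of_real d"
    and "t < 0" and "d > 0"
  shows "min (d / \<bar>t\<bar>) (\<bar>t\<bar> / 2) \<le> - Re r"
proof -
  have re: "Re r + Re s = t"
    using arg_cong[OF sum, of Re] by simp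
  from roots_real_or_same_Re[OF sum prod] show ?thesis
  proof
    assume "Im r = 0 \<and> Im s = 0"
    then have rs: "Re r * Re s = d"
      using arg_cong[OF prod, of Re] by simp
    have "Re r < 0"
    proof (rule ccontr)
      assume "\<not> Re r < 0"
      then have "Re r \<ge> 0" "Re s < 0"
        using re \<open>t < 0\<close> by linarith+
      then have "Re r * Re s \<le> 0"
        by (intro mult_nonneg_nonpos) simp_all
      then show False
        using rs \<open>d > 0\<close> by simp
    qed
    have "d = - Re r * \<bar>t\<bar> - (Re r)\<^sup>2"
      using re rs \<open>t < 0\<close> by (auto simp: algebra_simps power2_eq_square)
    then have "d \<le> - Re r * \<bar>t\<bar>"
      by simp
    then have "d / \<bar>t\<bar> \<le> - Re r"
      using \<open>t < 0\<close> by (simp add: field_simps)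
    then show ?thesis
      by simp
  next
    assume "Re r = Re s"
    then show ?thesis
      using re \<open>t < 0\<close> by simp
  qed
qed

text \<open>
  The root with the larger real part is the one that satisfies the bound: for real roots \<open>-x\<close> and
  \<open>-y\<close> with \<open>x \<le> y\<close>, it holds because \<open>x + y \<le> 2 y\<close>; for conjugate roots \<open>d = (t / 2)\<^sup>2 + (Im r)\<^sup>2\<close>.
\<close>

lemma neg_Re_root_le:
  assumes sum: "r + s = complex_of_real t" and prod: "r * s = complex_of_real d"
    and "t < 0" and "d > 0"
  shows "- Re r \<le> 2 * (d / \<bar>t\<bar>) \<or> - Re s \<le> 2 * (d / \<bar>t\<bar>)"
proof -
  have re: "Re r + Re s = t" and im: "Im r = - Im s"
    using arg_cong[OF sum, of Re] arg_cong[OF sum, of Im] by simp_all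
  have d: "Re r * Re s + Im s * Im s = d"
    using arg_cong[OF prod, of Re] im by simp
  have key: "- x \<le> 2 * (d / \<bar>t\<bar>)" if "x + y = t" "x * y \<le> d" "y \<le> x" "x \<le> 0" for x y
  proof -
    have "- x * \<bar>t\<bar> = x * x + x * y"
      using that(1) \<open>t < 0\<close> by (auto simp: algebra_simps)
    also have "x * x \<le> x * y"
      using that(3,4) by (intro mult_left_mono_neg)
    finally have "- x * \<bar>t\<bar> \<le> 2 * d"
      using that(2) by linarith
    then show ?thesis
      using \<open>t < 0\<close> by (simp add: field_simps)
  qed
  have rs: "Re r * Re s \<le> d"
    using d zero_le_square[of "Im s"] by linarith
  consider "Re r > 0 \<or> Re s > 0" | "Re s \<le> Re r" "Re r \<le> 0" | "Re r \<le> Re s" "Re s \<le> 0"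
    by linarith
  then show ?thesis
  proof cases
    case 1
    moreover have "0 \<le> 2 * (d / \<bar>t\<bar>)"
      using \<open>d > 0\<close> by simp
    ultimately show ?thesis
      by linarith
  next
    case 2
    then show ?thesis
      using key[of "Re r" "Re s"] re rs by simp
  next
    case 3
    then show ?thesis
      using key[of "Re s" "Re r"] re rs by (simp add: ac_simps)
  qed
qed

section \<open>Positive lower bounds\<close>

text \<open>
  The bound \<open>e\<close> is the leading coefficient.  It is positive, since otherwise \<open>p\<close> would be zero or
  eventually negative; and a polynomial with positive leading coefficient is eventually at least
  that coefficient, whether it is constant or tends to infinity.
\<close>

lemma poly_bounded_below_of_eventually_pos:
  fixes p :: "real poly"
  assumes "\<forall>\<^sub>F n::nat in sequentially. poly p (real n) > 0"
  obtains e where "e > 0" "\<forall>\<^sub>F n::nat in sequentially. e \<le> poly p (real n)"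
proof -
  have large: "\<forall>\<^sub>F n::nat in sequentially. poly q (real n) \<ge> lead_coeff q"
    if q: "lead_coeff q > 0" for q :: "real poly"
  proof -
    obtain a where "\<forall>x\<ge>a. poly q x \<ge> lead_coeff q"
      using poly_pinfty_gt_lc[OF q] by blast
    moreover have "\<forall>\<^sub>F n::nat in sequentially. a \<le> real n"
      using filterlim_real_sequentially by (simp add: filterlim_at_top)
    ultimately show ?thesis
      by (auto elim: eventually_mono)
  qed
  have "lead_coeff p > 0"
  proof (rule ccontr)
    assume "\<not> lead_coeff p > 0"
    then consider "p = 0" | "lead_coeff (- p) > 0"
      by (metis degree_minus coeff_minus leading_coeff_0_iff linorder_neqE_linordered_idom
          neg_0_less_iff_less)
    then have "\<forall>\<^sub>F n::nat in sequentially. poly p (real n) \<le> 0"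
    proof cases
      case 1
      then show ?thesis by simp
    next
      case 2
      have "\<forall>\<^sub>F n::nat in sequentially. poly (- p) (real n) \<ge> lead_coeff (- p)"
        by (rule large[OF 2])
      then show ?thesis
        by eventually_elim (use 2 in simp)
    qed
    with assms have "\<forall>\<^sub>F n::nat in sequentially. False"
      by eventually_elim simp
    then show False by simp
  qed
  then show thesis
    using that large by blast
qed

lemma pos_bounded_below_on:
  fixes f :: "nat \<Rightarrow> real"
  assumes pos: "\<And>n. n \<in> A \<Longrightarrow> f n > 0"
    and "e > 0" and ev: "\<forall>\<^sub>F n in sequentially. e \<le> f n"
  obtains c where "c > 0" "\<And>n. n \<in> A \<Longrightarrow> c \<le> f n"
proof -
  obtain N where N: "\<And>n. n \<ge> N \<Longrightarrow> e \<le> f n"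
    using ev by (auto simp: eventually_sequentially)
  define S where "S = insert e (f ` (A \<inter> {..<N}))"
  have S: "finite S" "S \<noteq> {}"
    by (auto simp: S_def)
  show thesis
  proof
    show "Min S > 0"
      using S pos \<open>e > 0\<close> by (auto simp: S_def)
    show "Min S \<le> f n" if "n \<in> A" for n
    proof (cases "n < N")
      case True
      then show ?thesis
        using S that by (intro Min_le) (auto simp: S_def)
    next
      case False
      moreover have "Min S \<le> e"
        using S by (intro Min_le) (auto simp: S_def)
      ultimately show ?thesis
        using N[of n] by simp
    qed
  qed
qed

section \<open>Trace and determinant as functions of the wave number\<close>

lemma symb_tr_minus: "symb_tr mL b l (- m) = symb_tr mL b l m"
  by (simp add: symb_tr_def trace_def sum_2 symb_entries)

text \<open>
  The off-diagonal entries are odd in \<open>m\<close>, so their product is even.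
\<close>

lemma symb_det_minus: "symb_det mL b l (- m) = symb_det mL b l m"
proof -
  have off: "symb mL b l (- m) $ 1 $ 2 = - symb mL b l m $ 1 $ 2"
       "symb mL b l (- m) $ 2 $ 1 = - symb mL b l m $ 2 $ 1"
    by (simp_all add: symb_entries sum_negf del: of_real_sum)
  have diag: "symb mL b l (- m) $ 1 $ 1 = symb mL b l m $ 1 $ 1"
       "symb mL b l (- m) $ 2 $ 2 = symb mL b l m $ 2 $ 2"
    by (simp_all add: symb_entries)
  show ?thesis
    unfolding symb_det_def det_2 off diag by simp
qed

lemma symb_tr_poly:
  obtains p :: "real poly" where "\<And>m. symb_tr mL b l m = poly p (of_int m)"
proof
  show "symb_tr mL b l m =
      poly (\<Sum>k\<le>mL. monom ((-1)^k * (b 1 (2*k) l + b 2 (2*k) l)) (2*k)) (of_int m)" for m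
    by (simp add: symb_tr_def trace_def sum_2 symb_entries poly_sum poly_monom
        sum.distrib[symmetric] algebra_simps del: of_real_sum)
qed

section \<open>The spectral gap criterion\<close>

theorem theorem2p13:
  fixes mL :: nat
    and b :: "nat \<Rightarrow> nat \<Rightarrow> real \<Rightarrow> real"
    and \<beta> :: "int \<Rightarrow> nat \<Rightarrow> real \<Rightarrow> complex"
    and m\<^sub>c :: int
    and l\<^sub>c :: real
  assumes "mL \<ge> 1"
    and "\<And>i k. i \<in> {1, 2} \<Longrightarrow> k \<le> 2 * mL + 1 \<Longrightarrow> smooth (b i k)"
    and "\<And>m l. m \<noteq> 0 \<Longrightarrow> eigenvalue_pair (symb mL b l m) (\<beta> m 1 l) (\<beta> m 2 l)"
    and "m\<^sub>c \<ge> 1"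
    and "symb_tr mL b l\<^sub>c m\<^sub>c = 0"
    and "\<And>m. m \<noteq> 0 \<Longrightarrow> symb_det mL b l\<^sub>c m > 0"
    and "deriv (\<lambda>l. symb_tr mL b l m\<^sub>c) l\<^sub>c \<noteq> 0"
    and "\<And>m. m \<noteq> 0 \<Longrightarrow> m \<noteq> m\<^sub>c \<Longrightarrow> m \<noteq> - m\<^sub>c \<Longrightarrow> symb_tr mL b l\<^sub>c m < 0"
  shows "(SUP (m, n) \<in> (UNIV - {0, m\<^sub>c, - m\<^sub>c}) \<times> {1, 2}. ereal (Re (\<beta> m n l\<^sub>c))) < 0
     \<longleftrightarrow> liminf (\<lambda>m::nat. ereal (symb_det mL b l\<^sub>c (int m) / \<bar>symb_tr mL b l\<^sub>c (int m)\<bar>)) > 0"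
proof -
  let ?t = "symb_tr mL b l\<^sub>c" and ?d = "symb_det mL b l\<^sub>c"
  define I where "I = UNIV - {0, m\<^sub>c, - m\<^sub>c}"
  define f where "f = (\<lambda>n. min (?d (int n) / \<bar>?t (int n)\<bar>) (\<bar>?t (int n)\<bar> / 2))"
  have t: "?t m < 0" and d: "?d m > 0" if "m \<in> I" for m
    using that assms(6,8) by (auto simp: I_def)
  have roots: "\<beta> m 1 l\<^sub>c + \<beta> m 2 l\<^sub>c = complex_of_real (?t m)"
      "\<beta> m 1 l\<^sub>c * \<beta> m 2 l\<^sub>c = complex_of_real (?d m)" if "m \<in> I" for m
    using that assms(3)[of m l\<^sub>c] by (auto simp: I_def eigenvalue_pair_iff trace_symb det_symb)
  have large: "\<forall>\<^sub>F n in sequentially. int n \<in> I"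
    using eventually_gt_at_top[of "nat m\<^sub>c"] by eventually_elim (use assms(4) in \<open>auto simp: I_def\<close>)
  show ?thesis
    unfolding I_def[symmetric]
  proof
    assume "(SUP (m, n) \<in> I \<times> {1, 2}. ereal (Re (\<beta> m n l\<^sub>c))) < 0"
    then obtain c where c: "(SUP (m, n) \<in> I \<times> {1, 2}. ereal (Re (\<beta> m n l\<^sub>c))) < ereal c" "ereal c < 0"
      using ereal_dense2 by blast
    have Re_le: "Re (\<beta> m n l\<^sub>c) \<le> c" if "m \<in> I" "n \<in> {1, 2}" for m n
    proof -
      have "ereal (Re (\<beta> m n l\<^sub>c)) \<le> (SUP (m, n) \<in> I \<times> {1, 2}. ereal (Re (\<beta> m n l\<^sub>c)))"
        using that by (intro SUP_upper2[of "(m, n)"]) auto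
      also note c(1)
      finally show ?thesis by simp
    qed
    have "- c / 2 \<le> ?d m / \<bar>?t m\<bar>" if "m \<in> I" for m
      using neg_Re_root_le[OF roots[OF that] t[OF that] d[OF that]]
        Re_le[OF that, of 1] Re_le[OF that, of 2] by auto
    then have "\<forall>\<^sub>F n in sequentially. ereal (- c / 2) \<le> ereal (?d (int n) / \<bar>?t (int n)\<bar>)"
      using large by (auto elim: eventually_mono)
    then have "ereal (- c / 2) \<le> liminf (\<lambda>n. ereal (?d (int n) / \<bar>?t (int n)\<bar>))"
      by (rule Liminf_bounded)
    moreover have "0 < ereal (- c / 2)"
      using c(2) by simp
    ultimately show "0 < liminf (\<lambda>n. ereal (?d (int n) / \<bar>?t (int n)\<bar>))"
      by (rule less_le_trans[rotated])
  next
    assume "0 < liminf (\<lambda>n. ereal (?d (int n) / \<bar>?t (int n)\<bar>))"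
    then obtain a where a: "0 < ereal a" "ereal a < liminf (\<lambda>n. ereal (?d (int n) / \<bar>?t (int n)\<bar>))"
      using ereal_dense2 by blast
    have ev_a: "\<forall>\<^sub>F n in sequentially. a < ?d (int n) / \<bar>?t (int n)\<bar>"
      using less_LiminfD[OF a(2)] by simp
    obtain p where p: "\<And>m. ?t m = poly p (of_int m)"
      using symb_tr_poly[of mL b "l\<^sub>c"] by blast
    have "\<forall>\<^sub>F n::nat in sequentially. poly (- p) (real n) > 0"
      using large by eventually_elim (use t p in force)
    then obtain e where e: "e > 0" "\<forall>\<^sub>F n::nat in sequentially. e \<le> poly (- p) (real n)"
      by (rule poly_bounded_below_of_eventually_pos)
    have f_pos: "f n > 0" if "n \<in> {n. int n \<in> I}" for n
      using t[of "int n"] d[of "int n"] that by (simp add: f_def divide_pos_neg)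
    have "\<forall>\<^sub>F n in sequentially. min a (e / 2) \<le> f n"
      using ev_a e(2) by eventually_elim (auto simp: f_def p)
    moreover have "min a (e / 2) > 0"
      using a(1) e(1) by simp
    moreover note f_pos
    ultimately obtain c where c: "c > 0" "\<And>n. n \<in> {n. int n \<in> I} \<Longrightarrow> c \<le> f n"
      using pos_bounded_below_on[of "{n. int n \<in> I}" f "min a (e / 2)"] by blast
    have Re_le: "Re (\<beta> m n l\<^sub>c) \<le> - c" if m: "m \<in> I" and n: "n \<in> {1, 2}" for m n
    proof -
      have even: "?t \<bar>m\<bar> = ?t m" "?d \<bar>m\<bar> = ?d m"
        by (auto simp: abs_if symb_tr_minus symb_det_minus)
      have "\<bar>m\<bar> \<in> I"
        using m by (auto simp: I_def abs_if)
      then have "c \<le> min (?d m / \<bar>?t m\<bar>) (\<bar>?t m\<bar> / 2)"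
        using c(2)[of "nat \<bar>m\<bar>"] by (simp add: f_def even)
      also have "\<dots> \<le> - Re (\<beta> m n l\<^sub>c)"
        using n min_le_neg_Re_root[OF roots[OF m] t[OF m] d[OF m]]
          min_le_neg_Re_root[of "\<beta> m 2 l\<^sub>c" "\<beta> m 1 l\<^sub>c", OF _ _ t[OF m] d[OF m]] roots[OF m]
        by (auto simp: ac_simps)
      finally show ?thesis by simp
    qed
    have "(SUP (m, n) \<in> I \<times> {1, 2}. ereal (Re (\<beta> m n l\<^sub>c))) \<le> ereal (- c)"
      using Re_le by (intro SUP_least) auto
    also have "\<dots> < 0"
      using c(1) by simp
    finally show "(SUP (m, n) \<in> I \<times> {1, 2}. ereal (Re (\<beta> m n l\<^sub>c))) < 0" .
  qed
qed

end
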